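(* Let $\Xi\subseteq\mathbb{R}^m$, equipped with a metric $d$, be a complete separable metric space, $\theta>0$, $\alpha\in(0,1)$, $X\subseteq\mathbb{R}^n$ closed and convex, and $\widehat\xi_1,\dots,\widehat\xi_N\in\Xi$. Let $F:\mathbb{R}^n\times\Xi\to\mathbb{R}$ be continuous and such that: for every $\xi\in\Xi$, $x\mapsto F(x,\xi)$ is convex on $X$; for every $x\in X$, $\xi\mapsto F(x,\xi)$ is bounded on $\Xi$, convex, and Lipschitz continuous with a constant $L_F>0$ that does not depend on $x\in X$. Let $$t^*:=\sup_{x\in X,\,\xi\in\Xi}-F(x,\xi),\qquad \delta_1:=\alpha-\frac{\theta L_F}{t^*},\qquad \delta_2:=\frac{\theta L_F}{\alpha}.$$ Then $$\widehat{X}_{\mathtt{SCP},\delta_2}\subseteq\widehat{X}^{\mathtt{in}}_{\mathtt{CDCP}}\subseteq\widehat{X}_{\mathtt{SA},\delta_1}.$$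
   Context: With $z_+:=\max(z,0)$, define $$\widehat{X}^{\mathtt{in}}_{\mathtt{CDCP}}:=\Bigl\{x\in X\;\Big|\;\theta L_F+\inf_{t\in\mathbb{R}}\Bigl[\frac1N\sum_{i=1}^N(F(x,\widehat\xi_i)+t)_+-t\alpha\Bigr]\le0\Bigr\},$$ $$\widehat{X}_{\mathtt{SA},\delta}:=\Bigl\{x\in X\;\Big|\;\frac1N\sum_{i=1}^N\mathbb{1}_{\{F(x,\widehat\xi_i)\le0\}}\ge1-\delta\Bigr\},$$ $$\widehat{X}_{\mathtt{SCP},\delta}:=\bigl\{x\in X\;\big|\;F(x,\widehat\xi_i)+\delta\le0\ \ \forall i\in\{1,\dots,N\}\bigr\}.$$ Lipschitz continuity in $\xi$ is with respect to $d$. If $t^*=+\infty$, then $\theta L_F/t^*$ is read as $0$. *)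

theory Defs
  imports "HOL-Analysis.Analysis"
begin

text \<open>
  Throughout, \<open>\<xi> 1, \<dots>, \<xi> N\<close> are the sample points.  In \<open>X_CDCP_in\<close> the infimum is taken in the
  extended reals, so that it is meaningful without a lower bound having to be established first.
\<close>

definition X_CDCP_in ::
  "'a set \<Rightarrow> ('a \<Rightarrow> 'b \<Rightarrow> real) \<Rightarrow> nat \<Rightarrow> (nat \<Rightarrow> 'b) \<Rightarrow> real \<Rightarrow> real \<Rightarrow> real \<Rightarrow> 'a set"
  where "X_CDCP_in X F N \<xi> \<theta> L \<alpha> =
    {x \<in> X. ereal (\<theta> * L) +
       (INF t \<in> (UNIV :: real set).
          ereal (1 / real N * (\<Sum>i = 1..N. max (F x (\<xi> i) + t) 0) - t * \<alpha>)) \<le> 0}"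

definition X_SA ::
  "'a set \<Rightarrow> ('a \<Rightarrow> 'b \<Rightarrow> real) \<Rightarrow> nat \<Rightarrow> (nat \<Rightarrow> 'b) \<Rightarrow> real \<Rightarrow> 'a set"
  where "X_SA X F N \<xi> \<delta> =
    {x \<in> X. 1 / real N * (\<Sum>i = 1..N. of_bool (F x (\<xi> i) \<le> 0)) \<ge> 1 - \<delta>}"

definition X_SCP ::
  "'a set \<Rightarrow> ('a \<Rightarrow> 'b \<Rightarrow> real) \<Rightarrow> nat \<Rightarrow> (nat \<Rightarrow> 'b) \<Rightarrow> real \<Rightarrow> 'a set"
  where "X_SCP X F N \<xi> \<delta> = {x \<in> X. \<forall>i \<in> {1..N}. F x (\<xi> i) + \<delta> \<le> 0}"

text \<open>The supremum may be \<open>\<infinity>\<close>, because \<open>F x\<close> need not be bounded uniformly in \<open>x\<close>.\<close>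

definition t_star :: "'a set \<Rightarrow> 'b set \<Rightarrow> ('a \<Rightarrow> 'b \<Rightarrow> real) \<Rightarrow> ereal"
  where "t_star X \<Xi> F = (SUP p \<in> X \<times> \<Xi>. ereal (- F (fst p) (snd p)))"

text \<open>
  The quotient \<open>\<theta> L / t\<^sup>*\<close> is read as \<open>0\<close> if \<open>t\<^sup>* = \<infinity>\<close>.  The junk values taken for \<open>t\<^sup>* = 0\<close> and
  \<open>t\<^sup>* = -\<infinity>\<close> are immaterial: if \<open>t\<^sup>* \<le> 0\<close> then \<open>F \<ge> 0\<close> on \<open>X \<times> \<Xi>\<close>, and \<open>X_CDCP_in\<close> is empty
  for \<open>\<theta> L > 0\<close> and \<open>0 < \<alpha> < 1\<close>.
\<close>

definition delta1 ::
  "'a set \<Rightarrow> 'b set \<Rightarrow> ('a \<Rightarrow> 'b \<Rightarrow> real) \<Rightarrow> real \<Rightarrow> real \<Rightarrow> real \<Rightarrow> real"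
  where "delta1 X \<Xi> F \<theta> L \<alpha> =
    \<alpha> - (if t_star X \<Xi> F = \<infinity> then 0 else \<theta> * L / real_of_ereal (t_star X \<Xi> F))"

definition delta2 :: "real \<Rightarrow> real \<Rightarrow> real \<Rightarrow> real"
  where "delta2 \<theta> L \<alpha> = \<theta> * L / \<alpha>"

end

(* The objective of the infimum is nonnegative for t <= 0.
   For 0 < t <= K, every sample with F > 0 contributes at least t to the sum of the positive parts
   F + t, so minus the objective at t is at most t (alpha - p), p being the fraction of such samples.
   For t beyond the largest value K of -F on the samples, the objective grows with slope 1 - alpha.
   So minus the infimum is at most max 0 (K (alpha - p)), and K <= t* bounds p.
   For the other inclusion, take t = delta_2. *)

theory Submission
  imports Defs
begin

text \<open>The bound is uniform in \<open>t\<close>, so it passes directly to the infimum. Any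
  nonnegative upper bound \<open>K\<close> of the values \<open>- a i\<close> will do. The
  \<open>max 0\<close> covers both \<open>t \<le> 0\<close> and a negative factor of
  \<open>K\<close>.\<close>

lemma CVaR_objective_ge:
  fixes a :: "nat \<Rightarrow> real"
  assumes "N \<ge> 1" "\<alpha> \<le> 1" "0 \<le> \<alpha>" "K \<ge> 0" and K: "\<And>i. i \<in> {1..N} \<Longrightarrow> - a i \<le> K"
  shows "- max 0 (K * (\<alpha> - 1 + 1 / real N * (\<Sum>i = 1..N. of_bool (a i \<le> 0))))
    \<le> 1 / real N * (\<Sum>i = 1..N. max (a i + t) 0) - t * \<alpha>"
proof (cases "t \<le> 0")
  case True
  have "t * \<alpha> \<le> 0"
    using True assms by (simp add: mult_nonpos_nonneg)
  moreover have "0 \<le> 1 / real N * (\<Sum>i = 1..N. max (a i + t) 0)"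
    by (intro mult_nonneg_nonneg sum_nonneg) auto
  ultimately show ?thesis
    by linarith
next
  case False
  define q where "q = 1 / real N * (\<Sum>i = 1..N. of_bool (a i \<le> 0))"
  \<comment> \<open>Truncating at \<open>K\<close> treats \<open>t \<le> K\<close> and
    \<open>t > K\<close> together.\<close>
  define s where "s = min t K"
  have s: "0 \<le> s" "s \<le> t" "s \<le> K"
    using False \<open>K \<ge> 0\<close> by (auto simp: s_def)
  \<comment> \<open>If \<open>a i > 0\<close>, the positive part exceeds \<open>t\<close>. Otherwise
    it is at least both \<open>0\<close> and \<open>t - K\<close>, hence at least
    \<open>t - s\<close>.\<close>
  have "t - s * of_bool (a i \<le> 0) \<le> max (a i + t) 0" if "i \<in> {1..N}" for i
    using K[OF that] False by (auto simp: s_def min_def max_def)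
  then have "(\<Sum>i = 1..N. t - s * of_bool (a i \<le> 0)) \<le> (\<Sum>i = 1..N. max (a i + t) 0)"
    by (intro sum_mono)
  then have "1 / real N * (\<Sum>i = 1..N. t - s * of_bool (a i \<le> 0))
      \<le> 1 / real N * (\<Sum>i = 1..N. max (a i + t) 0)"
    by (intro mult_left_mono) auto
  moreover have "1 / real N * (\<Sum>i = 1..N. t - s * of_bool (a i \<le> 0)) = t - s * q"
    using \<open>N \<ge> 1\<close> unfolding q_def sum_subtractf sum_distrib_left[symmetric]
    by (simp add: field_simps)
  moreover have "t * \<alpha> - (t - s * q) = s * (\<alpha> - 1 + q) - (t - s) * (1 - \<alpha>)"
    by (simp add: algebra_simps)
  moreover have "0 \<le> (t - s) * (1 - \<alpha>)"
    using s assms by simp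
  \<comment> \<open>A linear function of \<open>s\<close> on the interval from 0 to \<open>K\<close>
    is largest at an endpoint.\<close>
  moreover have "s * (\<alpha> - 1 + q) \<le> max 0 (K * (\<alpha> - 1 + q))"
  proof (cases "\<alpha> - 1 + q \<ge> 0")
    case True
    then show ?thesis
      using s by (simp add: mult_right_mono max.coboundedI2)
  next
    case False
    then show ?thesis
      using s by (simp add: mult_nonneg_nonpos max.coboundedI1)
  qed
  ultimately show ?thesis
    unfolding q_def by linarith
qed

lemma X_SCP_subset_X_CDCP_in:
  assumes "\<alpha> > 0"
  shows "X_SCP X F N \<xi> (delta2 \<theta> L \<alpha>) \<subseteq> X_CDCP_in X F N \<xi> \<theta> L \<alpha>"
proof
  fix x assume x: "x \<in> X_SCP X F N \<xi> (delta2 \<theta> L \<alpha>)"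
  \<comment> \<open>With this \<open>t\<close>, membership in \<open>X_SCP\<close> makes every
    positive part vanish, and the remaining term \<open>- t * \<alpha>\<close> cancels
    \<open>\<theta> * L\<close> exactly.\<close>
  define t where "t = \<theta> * L / \<alpha>"
  have "(\<Sum>i = 1..N. max (F x (\<xi> i) + t) 0) = 0"
    using x by (intro sum.neutral) (auto simp: X_SCP_def delta2_def t_def)
  then have obj: "1 / real N * (\<Sum>i = 1..N. max (F x (\<xi> i) + t) 0) - t * \<alpha> = - (\<theta> * L)"
    using \<open>\<alpha> > 0\<close> by (simp add: t_def)
  have "(INF t \<in> UNIV. ereal (1 / real N * (\<Sum>i = 1..N. max (F x (\<xi> i) + t) 0) - t * \<alpha>))
      \<le> ereal (- (\<theta> * L))"
    using INF_lower[of t UNIV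
        "\<lambda>t. ereal (1 / real N * (\<Sum>i = 1..N. max (F x (\<xi> i) + t) 0) - t * \<alpha>)"]
    unfolding obj by simp
  from add_left_mono[OF this, of "ereal (\<theta> * L)"]
  show "x \<in> X_CDCP_in X F N \<xi> \<theta> L \<alpha>"
    using x by (simp add: X_CDCP_in_def X_SCP_def zero_ereal_def)
qed

lemma X_CDCP_in_subset_X_SA:
  assumes "\<theta> * L > 0" "0 \<le> \<alpha>" "\<alpha> \<le> 1" "N \<ge> 1" and \<xi>: "\<And>i. i \<in> {1..N} \<Longrightarrow> \<xi> i \<in> \<Xi>"
  shows "X_CDCP_in X F N \<xi> \<theta> L \<alpha> \<subseteq> X_SA X F N \<xi> (delta1 X \<Xi> F \<theta> L \<alpha>)"
proof
  fix x assume x: "x \<in> X_CDCP_in X F N \<xi> \<theta> L \<alpha>"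
  define q where "q = 1 / real N * (\<Sum>i = 1..N. of_bool (F x (\<xi> i) \<le> 0))"
  \<comment> \<open>Inserting 0 secures \<open>K \<ge> 0\<close> before it is known that
    \<open>F x\<close> is negative at some sample.\<close>
  define K where "K = Max (insert 0 ((\<lambda>i. - F x (\<xi> i)) ` {1..N}))"
  have K: "- F x (\<xi> i) \<le> K" if "i \<in> {1..N}" for i
    using that unfolding K_def by (intro Max_ge) auto
  have K0: "K \<ge> 0"
    unfolding K_def by (intro Max_ge) auto
  have "ereal (- max 0 (K * (\<alpha> - 1 + q)))
      \<le> (INF t \<in> UNIV. ereal (1 / real N * (\<Sum>i = 1..N. max (F x (\<xi> i) + t) 0) - t * \<alpha>))"
    unfolding q_def using assms K K0
    by (intro INF_greatest) (simp only: ereal_less_eq, rule CVaR_objective_ge, auto)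
  note add_left_mono[OF this, of "ereal (\<theta> * L)"]
  also have "ereal (\<theta> * L) + (INF t \<in> UNIV.
      ereal (1 / real N * (\<Sum>i = 1..N. max (F x (\<xi> i) + t) 0) - t * \<alpha>)) \<le> 0"
    using x unfolding X_CDCP_in_def by blast
  finally have "ereal (\<theta> * L) + ereal (- max 0 (K * (\<alpha> - 1 + q))) \<le> 0" .
  then have "\<theta> * L \<le> max 0 (K * (\<alpha> - 1 + q))"
    by (simp add: zero_ereal_def)
  \<comment> \<open>Since \<open>\<theta> * L > 0\<close>, the maximum is not 0. Both factors of the
    product are then positive.\<close>
  then have le: "\<theta> * L \<le> K * (\<alpha> - 1 + q)"
    using \<open>\<theta> * L > 0\<close> by linarith
  then have Kpos: "K > 0"
    using K0 \<open>\<theta> * L > 0\<close> by (cases "K = 0") auto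
  have pos: "\<alpha> - 1 + q > 0"
    using le \<open>\<theta> * L > 0\<close> Kpos by (metis less_le_trans zero_less_mult_pos)
  \<comment> \<open>Being positive, \<open>K\<close> is not the inserted 0 but a value of
    \<open>- F x\<close> at a sample, so \<open>t_star\<close> bounds it.\<close>
  have "K \<in> insert 0 ((\<lambda>i. - F x (\<xi> i)) ` {1..N})"
    unfolding K_def by (intro Max_in) auto
  then obtain i where i: "i \<in> {1..N}" "K = - F x (\<xi> i)"
    using Kpos by auto
  have "x \<in> X"
    using x by (simp add: X_CDCP_in_def)
  then have Kt: "ereal K \<le> t_star X \<Xi> F"
    unfolding t_star_def using i \<xi>
    by (intro SUP_upper2[of "(x, \<xi> i)"]) auto
  have "1 - delta1 X \<Xi> F \<theta> L \<alpha> \<le> q"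
  \<comment> \<open>A finite \<open>t_star\<close> is at least \<open>K > 0\<close>, so replacing
    \<open>K\<close> by it and dividing are both legitimate. If it is infinite, the quotient is read
    as 0 and positivity of \<open>\<alpha> - 1 + q\<close> suffices.\<close>
  proof (cases "t_star X \<Xi> F")
    case (real T)
    then have "K \<le> T"
      using Kt by simp
    then have "\<theta> * L \<le> T * (\<alpha> - 1 + q)"
      using le mult_right_mono[of K T "\<alpha> - 1 + q"] pos by linarith
    then have "\<theta> * L / T \<le> \<alpha> - 1 + q"
      using Kpos \<open>K \<le> T\<close> by (simp add: field_simps)
    then show ?thesis
      using real by (simp add: delta1_def)
  next
    case PInf
    then show ?thesis
      using pos by (simp add: delta1_def)
  next
    case MInf
    then show ?thesis
      using Kt by simp
  qed
  then show "x \<in> X_SA X F N \<xi> (delta1 X \<Xi> F \<theta> L \<alpha>)"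
    using \<open>x \<in> X\<close> by (simp add: X_SA_def q_def)
qed

theorem propositionV9:
  fixes \<Xi> :: "(real ^ 'm) set"
    and d :: "real ^ 'm \<Rightarrow> real ^ 'm \<Rightarrow> real"
    and X :: "(real ^ 'n) set"
    and F :: "real ^ 'n \<Rightarrow> real ^ 'm \<Rightarrow> real"
    and N :: nat
    and \<xi> :: "nat \<Rightarrow> real ^ 'm"
    and \<theta> \<alpha> L\<^sub>F :: real
  assumes "Metric_space \<Xi> d"
    and "Metric_space.mcomplete \<Xi> d"
    and "separable_space (Metric_space.mtopology \<Xi> d)"
    and "\<theta> > 0"
    and "0 < \<alpha>" and "\<alpha> < 1"
    and "closed X" and "convex X"
    and "N \<ge> 1"
    and "\<And>i. i \<in> {1..N} \<Longrightarrow> \<xi> i \<in> \<Xi>"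
    and "continuous_map (prod_topology euclidean (Metric_space.mtopology \<Xi> d)) euclideanreal
           (\<lambda>(x, \<zeta>). F x \<zeta>)"
    and "\<And>\<zeta>. \<zeta> \<in> \<Xi> \<Longrightarrow> convex_on X (\<lambda>x. F x \<zeta>)"
    and "\<And>x. x \<in> X \<Longrightarrow> bounded (F x ` \<Xi>)"
    and "\<And>x. x \<in> X \<Longrightarrow> convex_on \<Xi> (F x)"
    and "L\<^sub>F > 0"
    and "\<And>x \<zeta> \<eta>. x \<in> X \<Longrightarrow> \<zeta> \<in> \<Xi> \<Longrightarrow> \<eta> \<in> \<Xi> \<Longrightarrow> \<bar>F x \<zeta> - F x \<eta>\<bar> \<le> L\<^sub>F * d \<zeta> \<eta>"
  shows "X_SCP X F N \<xi> (delta2 \<theta> L\<^sub>F \<alpha>) \<subseteq> X_CDCP_in X F N \<xi> \<theta> L\<^sub>F \<alpha>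
       \<and> X_CDCP_in X F N \<xi> \<theta> L\<^sub>F \<alpha> \<subseteq> X_SA X F N \<xi> (delta1 X \<Xi> F \<theta> L\<^sub>F \<alpha>)"
proof (intro conjI)
  show "X_SCP X F N \<xi> (delta2 \<theta> L\<^sub>F \<alpha>) \<subseteq> X_CDCP_in X F N \<xi> \<theta> L\<^sub>F \<alpha>"
    using \<open>0 < \<alpha>\<close> by (rule X_SCP_subset_X_CDCP_in)
  show "X_CDCP_in X F N \<xi> \<theta> L\<^sub>F \<alpha> \<subseteq> X_SA X F N \<xi> (delta1 X \<Xi> F \<theta> L\<^sub>F \<alpha>)"
    using assms by (intro X_CDCP_in_subset_X_SA) auto
qed

end
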